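(* Let $x\in(0,1)$ be irrational. If $(p,q)$ is an odd candidate pair for $x$, then there is a proper continued fraction expansion of $x$ for which $p=p_1$ and $q=q_1$.
   Context: A proper continued fraction (PCF) expansion of an irrational $x\in(0,1)$ consists of sequences of positive integers $(a_n)_{n\ge1}$, $(b_n)_{n\ge1}$ with $b_n\ge a_n$ for all $n$ such that $$x=\cfrac{a_1}{b_1+\cfrac{a_2}{b_2+\ddots}},$$ meaning $x=\lim_{n\to\infty}p_n/q_n$, where $p_{-1}=1,\ p_0=0,\ q_{-1}=0,\ q_0=1$ and $p_n=b_np_{n-1}+a_np_{n-2}$, $q_n=b_nq_{n-1}+a_nq_{n-2}$ for $n\ge1$ (common factors of $p_n,q_n$ are not cancelled; in particular $p_1=a_1$, $q_1=b_1$). For a given sequence of numerators $(a_n)$ the expansion is unique and is produced by $x_0=x$, $b_n=\lfloor a_n/x_{n-1}\rfloor$, $x_n=a_n/x_{n-1}-b_n$. A pair of positive integers $(p,q)$ (not necessarily coprime) is a candidate for $x$ if $|x-p/q|<x/q$; it is an odd candidate pair if moreover $p/q>x$, and an even candidate pair if moreover $p/q<x$. *)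

theory Defs
  imports Complex_Main
begin

text \<open>
  The sequences \<open>a\<close>, \<open>b\<close> are indexed by \<open>n \<ge> 1\<close>; their values at \<open>0\<close> are never used.
  The recurrence \<open>p n = b n * p (n - 1) + a n * p (n - 2)\<close> of the convergents is started with
  \<open>p (-1) = 1\<close>, \<open>p 0 = 0\<close> and \<open>q (-1) = 0\<close>, \<open>q 0 = 1\<close>; the second equation is the instance
  \<open>n = 1\<close>, with the value at \<open>-1\<close> inserted.
\<close>

fun pcf_num :: "(nat \<Rightarrow> nat) \<Rightarrow> (nat \<Rightarrow> nat) \<Rightarrow> nat \<Rightarrow> nat" where
  "pcf_num a b 0 = 0"
| "pcf_num a b (Suc 0) = b 1 * pcf_num a b 0 + a 1 * 1"
| "pcf_num a b (Suc (Suc n)) =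
     b (Suc (Suc n)) * pcf_num a b (Suc n) + a (Suc (Suc n)) * pcf_num a b n"

fun pcf_den :: "(nat \<Rightarrow> nat) \<Rightarrow> (nat \<Rightarrow> nat) \<Rightarrow> nat \<Rightarrow> nat" where
  "pcf_den a b 0 = 1"
| "pcf_den a b (Suc 0) = b 1 * pcf_den a b 0 + a 1 * 0"
| "pcf_den a b (Suc (Suc n)) =
     b (Suc (Suc n)) * pcf_den a b (Suc n) + a (Suc (Suc n)) * pcf_den a b n"

definition pcf_expansion :: "(nat \<Rightarrow> nat) \<Rightarrow> (nat \<Rightarrow> nat) \<Rightarrow> real \<Rightarrow> bool" where
  "pcf_expansion a b x \<longleftrightarrow>
     (\<forall>n\<ge>1. 0 < a n \<and> 0 < b n \<and> a n \<le> b n) \<and>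
     (\<lambda>n. real (pcf_num a b n) / real (pcf_den a b n)) \<longlonglongrightarrow> x"

definition candidate_pair :: "real \<Rightarrow> nat \<Rightarrow> nat \<Rightarrow> bool" where
  "candidate_pair x p q \<longleftrightarrow> 0 < p \<and> 0 < q \<and> \<bar>x - real p / real q\<bar> < x / real q"

definition odd_candidate_pair :: "real \<Rightarrow> nat \<Rightarrow> nat \<Rightarrow> bool" where
  "odd_candidate_pair x p q \<longleftrightarrow> candidate_pair x p q \<and> real p / real q > x"

end

theory Submission
  imports Defs
begin

text \<open>
  For \<open>p/q > x\<close> the candidate condition says \<open>0 < p/x - q < 1\<close>, that is \<open>q = \<lfloor>p/x\<rfloor>\<close>. So any
  expansion algorithm whose first numerator is \<open>p\<close> has first convergent \<open>p/q\<close>, and the later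
  numerators may be chosen freely. The algorithm converges because the errors
  \<open>q\<^sub>n x - p\<^sub>n\<close> equal \<open>(-1)\<^sup>n x\<^sub>0 \<dots> x\<^sub>n\<close>, hence are bounded, while \<open>q\<^sub>n\<close> tends to infinity.
\<close>

primrec pcf_tail :: "(nat \<Rightarrow> nat) \<Rightarrow> real \<Rightarrow> nat \<Rightarrow> real" where
  "pcf_tail a x 0 = x"
| "pcf_tail a x (Suc n) = frac (real (a (Suc n)) / pcf_tail a x n)"

text \<open>Meant for \<open>n \<ge> 1\<close>, like the denominators \<open>b\<close> in
  \<open>pcf_num\<close> and \<open>pcf_den\<close>; at 0 the natural subtraction truncates and the
  value is a mere default.\<close>

definition pcf_digit :: "(nat \<Rightarrow> nat) \<Rightarrow> real \<Rightarrow> nat \<Rightarrow> nat" where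
  "pcf_digit a x n = nat \<lfloor>real (a n) / pcf_tail a x (n - 1)\<rfloor>"

lemma frac_irrational: "y \<notin> \<rat> \<Longrightarrow> frac y \<notin> \<rat>" for y :: real
  by (metis Rats_add Rats_of_int frac_def diff_add_cancel)

lemma irrational_of_nat_divide:
  fixes y :: real
  assumes "y \<notin> \<rat>" and "0 < k"
  shows "real k / y \<notin> \<rat>"
proof
  assume "real k / y \<in> \<rat>"
  then have "real k / (real k / y) \<in> \<rat>"
    by (rule Rats_divide[OF Rats_of_nat])
  moreover have "real k / (real k / y) = y" using assms(2) by simp
  ultimately show False using assms(1) by simp
qed

lemma pcf_tail_irrational:
  assumes "\<forall>n. 0 < a n" and "x \<notin> \<rat>"
  shows "pcf_tail a x n \<notin> \<rat>"
  by (induction n) (simp_all add: assms frac_irrational irrational_of_nat_divide)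

text \<open>A fractional part can fail to lie in (0,1) only by being 0, and irrationality, inherited
  by every tail, excludes that. So the algorithm never stops.\<close>

lemma pcf_tail_bounds:
  assumes "\<forall>n. 0 < a n" and "x \<notin> \<rat>" and "0 < x" and "x < 1"
  shows "0 < pcf_tail a x n" and "pcf_tail a x n < 1"
proof -
  have "pcf_tail a x n \<noteq> 0"
    using pcf_tail_irrational[OF assms(1,2), of n] by auto
  moreover have "0 \<le> pcf_tail a x n \<and> pcf_tail a x n < 1"
    using assms(3,4) by (cases n) (simp_all add: frac_lt_1)
  ultimately show "0 < pcf_tail a x n" and "pcf_tail a x n < 1" by auto
qed

lemma pcf_digit_Suc:
  assumes "\<forall>n. 0 < a n" and "x \<notin> \<rat>" and "0 < x" and "x < 1"
  shows "real (pcf_digit a x (Suc n)) = real (a (Suc n)) / pcf_tail a x n - pcf_tail a x (Suc n)"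
proof -
  have "0 \<le> real (a (Suc n)) / pcf_tail a x n"
    using pcf_tail_bounds(1)[OF assms, of n] by simp
  then show ?thesis by (simp add: pcf_digit_def frac_def)
qed

text \<open>Dividing by a tail below 1 does not decrease the integer \<open>a (Suc n)\<close>, so it
  survives taking the floor. This is the condition that makes the expansion proper.\<close>

lemma pcf_digit_ge:
  assumes "\<forall>n. 0 < a n" and "x \<notin> \<rat>" and "0 < x" and "x < 1"
  shows "a (Suc n) \<le> pcf_digit a x (Suc n)"
proof -
  have "real (a (Suc n)) \<le> real (a (Suc n)) / pcf_tail a x n"
    using pcf_tail_bounds[OF assms, of n] by (simp add: pos_le_divide_eq mult_left_le)
  then show ?thesis by (simp add: pcf_digit_def le_nat_iff le_floor_iff)
qed

text \<open>With coefficients at least 1, each denominator is at least the sum of the two before it.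
  Positivity is carried along because the older summand supplies the extra 1 in the induction for
  the linear bound.\<close>

lemma pcf_den_ge:
  assumes "\<And>n. 1 \<le> n \<Longrightarrow> 0 < a n" and "\<And>n. 1 \<le> n \<Longrightarrow> 0 < b n"
  shows "0 < pcf_den a b n \<and> n \<le> pcf_den a b n"
  using assms
proof (induction a b n rule: pcf_den.induct)
  case (3 a b n)
  have "pcf_den a b (Suc n) \<le> b (Suc (Suc n)) * pcf_den a b (Suc n)"
    and "pcf_den a b n \<le> a (Suc (Suc n)) * pcf_den a b n"
    using "3.prems"[of "Suc (Suc n)"] by simp_all
  moreover have "0 < pcf_den a b n \<and> n \<le> pcf_den a b n"
    and "0 < pcf_den a b (Suc n) \<and> Suc n \<le> pcf_den a b (Suc n)"
    using "3.IH"[OF "3.prems"] by simp_all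
  ultimately show ?case unfolding pcf_den.simps by linarith
qed (auto simp: Suc_le_eq)

text \<open>Numerators and denominators obey the same linear recurrence, hence so does
  \<open>\<delta>\<close>. The relation defining the next tail turns its coefficients into those for
  which multiplication by minus the tail persists.\<close>

lemma pcf_error_Suc:
  assumes "\<forall>n. 0 < a n" and "x \<notin> \<rat>" and "0 < x" and "x < 1"
  defines "b \<equiv> pcf_digit a x"
  defines "\<delta> \<equiv> (\<lambda>n. real (pcf_den a b n) * x - real (pcf_num a b n))"
  shows "\<delta> (Suc n) = - pcf_tail a x (Suc n) * \<delta> n"
proof (induction n)
  case 0
  show ?case
    using pcf_digit_Suc[OF assms(1-4), of 0] assms(3)
    by (simp add: \<delta>_def b_def left_diff_distrib)
next
  case (Suc n)
  let ?s = "pcf_tail a x (Suc n)" and ?t = "pcf_tail a x (Suc (Suc n))"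
  have "?s > 0"
    using pcf_tail_bounds(1)[OF assms(1-4)] .
  moreover have "real (b (Suc (Suc n))) = real (a (Suc (Suc n))) / ?s - ?t"
    unfolding b_def by (rule pcf_digit_Suc[OF assms(1-4)])
  ultimately have a: "real (a (Suc (Suc n))) = real (b (Suc (Suc n))) * ?s + ?t * ?s"
    by (simp add: left_diff_distrib del: pcf_tail.simps)
  have \<delta>: "\<delta> (Suc (Suc n)) = real (b (Suc (Suc n))) * \<delta> (Suc n) + real (a (Suc (Suc n))) * \<delta> n"
    by (simp add: \<delta>_def algebra_simps)
  \<comment> \<open>After \<open>a\<close> is substituted, the two terms
    \<open>b (Suc (Suc n)) * ?s * \<delta> n\<close> cancel and \<open>?t * ?s * \<delta> n\<close>
    remains, which is \<open>- ?t * \<delta> (Suc n)\<close> by the induction hypothesis.\<close>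
  show ?case
    unfolding \<delta> a Suc.IH by (simp add: distrib_right del: pcf_tail.simps)
qed

text \<open>The initial error is \<open>x\<close> itself, and each later one arises from its
  predecessor by a factor of absolute value below 1.\<close>

lemma pcf_error_bound:
  assumes "\<forall>n. 0 < a n" and "x \<notin> \<rat>" and "0 < x" and "x < 1"
  defines "b \<equiv> pcf_digit a x"
  shows "\<bar>real (pcf_den a b n) * x - real (pcf_num a b n)\<bar> \<le> 1"
proof (induction n)
  case 0
  show ?case using assms(3,4) by simp
next
  case (Suc n)
  have "\<bar>pcf_tail a x (Suc n)\<bar> \<le> 1"
    using pcf_tail_bounds[OF assms(1-4), of "Suc n"] by simp
  with Suc show ?case
    unfolding b_def pcf_error_Suc[OF assms(1-4)] abs_mult abs_minus_cancel
    by (intro mult_le_one) auto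
qed

lemma pcf_expansion_pcf_digit:
  assumes "\<forall>n. 0 < a n" and "x \<notin> \<rat>" and "0 < x" and "x < 1"
  shows "pcf_expansion a (pcf_digit a x) x"
  unfolding pcf_expansion_def
proof (intro conjI allI impI)
  fix n :: nat
  show "0 < a n" using assms(1) by blast
next
  fix n :: nat
  assume "1 \<le> n"
  then show "a n \<le> pcf_digit a x n"
    using pcf_digit_ge[OF assms, of "n - 1"] by simp
  with assms(1)[rule_format, of n] show "0 < pcf_digit a x n" by linarith
next
  let ?P = "pcf_num a (pcf_digit a x)" and ?Q = "pcf_den a (pcf_digit a x)"
  have "0 < pcf_digit a x n" if "1 \<le> n" for n
    using pcf_digit_ge[OF assms, of "n - 1"] assms(1)[rule_format, of n] that by simp
  then have Q: "0 < ?Q n \<and> n \<le> ?Q n" for n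
    by (rule pcf_den_ge[OF assms(1)[rule_format]])
  \<comment> \<open>The error is at most 1 and gets divided by \<open>?Q n \<ge> n\<close>. The
    index 0 has to be excluded: there \<open>1 / real n\<close> is 0, but the left side is
    \<open>x\<close>.\<close>
  have "norm (real (?P n) / real (?Q n) - x) \<le> 1 / real n" if "1 \<le> n" for n
  proof -
    have "real (?P n) / real (?Q n) - x = - (real (?Q n) * x - real (?P n)) / real (?Q n)"
      using Q[of n] by (simp add: field_simps)
    then have "norm (real (?P n) / real (?Q n) - x) = \<bar>real (?Q n) * x - real (?P n)\<bar> / real (?Q n)"
      by (simp only: real_norm_def abs_divide abs_minus_cancel abs_of_nat)
    also have "\<dots> \<le> 1 / real n"
      using pcf_error_bound[OF assms, of n] Q[of n] that by (intro frac_le) simp_all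
    finally show ?thesis .
  qed
  then have "(\<lambda>n. real (?P n) / real (?Q n) - x) \<longlonglongrightarrow> 0"
    by (intro tendsto_0_le[OF lim_1_over_n[where 'a = real], of _ 1] eventually_sequentiallyI[of 1]) simp
  then show "(\<lambda>n. real (?P n) / real (?Q n)) \<longlonglongrightarrow> x"
    by (rule LIM_zero_cancel)
qed

theorem proposition3p6:
  fixes x :: real and p q :: nat
  assumes "0 < x" and "x < 1" and "x \<notin> \<rat>"
    and "odd_candidate_pair x p q"
  shows "\<exists>a b. pcf_expansion a b x \<and> p = pcf_num a b 1 \<and> q = pcf_den a b 1"
proof -
  have "0 < p" "0 < q" and close: "\<bar>x - real p / real q\<bar> < x / real q" and odd: "x < real p / real q"
    using assms(4) unfolding odd_candidate_pair_def candidate_pair_def by blast+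
  \<comment> \<open>The upper half of \<open>close\<close>; cleared of denominators it reads
    \<open>p < x * (q + 1)\<close>, and \<open>odd\<close> reads \<open>q * x < p\<close>. Division
    by \<open>x\<close> places \<open>p / x\<close> strictly between \<open>q\<close> and
    \<open>q + 1\<close>.\<close>
  have "real p / real q < (x + x * real q) / real q"
    using close \<open>0 < q\<close> by (simp add: abs_less_iff add_divide_distrib)
  then have "real p < x * (real q + 1)" and "real q * x < real p"
    using odd \<open>0 < q\<close> by (simp_all add: divide_less_cancel field_simps)
  then have "\<lfloor>real p / x\<rfloor> = int q"
    using assms(1) by (intro floor_unique) (simp_all add: field_simps)
  then have "q = pcf_digit (\<lambda>_. p) x 1"
    by (simp add: pcf_digit_def)
  \<comment> \<open>Only the first numerator is prescribed; repeating \<open>p\<close> keeps all of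
    them positive.\<close>
  moreover have "pcf_expansion (\<lambda>_. p) (pcf_digit (\<lambda>_. p) x) x"
    using \<open>0 < p\<close> assms(1-3) by (intro pcf_expansion_pcf_digit) auto
  ultimately show ?thesis
    by (intro exI[of _ "\<lambda>_. p"] exI[of _ "pcf_digit (\<lambda>_. p) x"]) simp
qed

end
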